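(* Let $\Gamma:[0,1]^2\to\mathbb R$ be a continuous covariance kernel (continuous, symmetric, positive semidefinite), with orthonormal eigenfunctions $\phi_j$ and associated eigenvalues $\lambda_1\ge\lambda_2\ge\dots\ge 0$ of its integral operator. Let $\hat\Gamma:[0,1]^2\to\mathbb R$ be a continuous symmetric kernel (not necessarily positive semidefinite), with orthonormal eigenfunctions $\hat\phi_j$ and eigenvalues $\hat\lambda_1\ge\hat\lambda_2\ge\dots$ of its integral operator. For a given $k\ge 1$ suppose that $\lambda_k>0$ is a simple eigenvalue, so that the spectral gap $\delta_k$ is positive, and that $\hat\lambda_k>0$. Then, with $c_k=\operatorname{sign}(\langle\hat\phi_k,\phi_k\rangle)$, $$\|\hat\phi_k-c_k\,\phi_k\|_\infty\ \le\ \|\hat\Gamma-\Gamma\|_\infty\left(\frac1{\hat\lambda_k}+\frac{\|\Gamma\|_\infty}{\hat\lambda_k\,\lambda_k}+\frac{2\sqrt2\,\|\Gamma\|_\infty}{\delta_k\,\lambda_k}\right).$$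
   Context: For a continuous symmetric kernel $G$ on $[0,1]^2$, the associated integral operator on $L_2[0,1]$ is $(T_Gf)(x)=\int_0^1G(x,y)f(y)\,dy$; it is compact and self-adjoint. Eigenvalues are repeated according to multiplicity, and eigenfunctions are normalized in $L_2[0,1]$ (eigenfunctions for non-zero eigenvalues are identified with their continuous versions). For $\hat\Gamma$, $\hat\lambda_k>0$ means that $T_{\hat\Gamma}$ has at least $k$ positive eigenvalues counted with multiplicity, and $\hat\lambda_k$ is the $k$-th largest. $\langle\cdot,\cdot\rangle$ is the inner product of $L_2[0,1]$, and $\|\cdot\|_\infty$ is the supremum norm on $[0,1]$ or $[0,1]^2$. The spectral gap is $\delta_k=\min(\lambda_{k-1}-\lambda_k,\lambda_k-\lambda_{k+1})$ for $k\ge2$ and $\delta_1=\lambda_1-\lambda_2$. *)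

theory Defs
  imports "HOL-Analysis.Analysis" "HOL-Library.Extended_Nat"
begin

abbreviation unit_measure :: "real measure"
  where "unit_measure \<equiv> lebesgue_on {0..1}"

abbreviation unit_square :: "(real \<times> real) set"
  where "unit_square \<equiv> {0..1} \<times> {0..1}"

text \<open>
  Elements of \<open>L\<^sub>2[0,1]\<close> are represented by functions on \<open>real\<close>, identified when they agree
  almost everywhere on the unit interval; values outside \<open>{0..1}\<close> are irrelevant.
\<close>

definition L2_unit :: "(real \<Rightarrow> real) set"
  where "L2_unit = {f. f \<in> borel_measurable unit_measure \<and>
                       integrable unit_measure (\<lambda>x. (f x)\<^sup>2)}"

definition L2_inner :: "(real \<Rightarrow> real) \<Rightarrow> (real \<Rightarrow> real) \<Rightarrow> real"
  where "L2_inner f g = (\<integral>x. f x * g x \<partial>unit_measure)"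

definition integral_operator ::
    "(real \<times> real \<Rightarrow> real) \<Rightarrow> (real \<Rightarrow> real) \<Rightarrow> real \<Rightarrow> real"
  where "integral_operator G f x = (\<integral>y. G (x, y) * f y \<partial>unit_measure)"

definition symmetric_kernel :: "(real \<times> real \<Rightarrow> real) \<Rightarrow> bool"
  where "symmetric_kernel G \<longleftrightarrow> (\<forall>x\<in>{0..1}. \<forall>y\<in>{0..1}. G (x, y) = G (y, x))"

definition positive_semidefinite_kernel :: "(real \<times> real \<Rightarrow> real) \<Rightarrow> bool"
  where "positive_semidefinite_kernel G \<longleftrightarrow>
    (\<forall>X a. finite X \<longrightarrow> X \<subseteq> {0..1} \<longrightarrow> 0 \<le> (\<Sum>x\<in>X. \<Sum>y\<in>X. a x * a y * G (x, y)))"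

definition covariance_kernel :: "(real \<times> real \<Rightarrow> real) \<Rightarrow> bool"
  where "covariance_kernel G \<longleftrightarrow>
    continuous_on unit_square G \<and> symmetric_kernel G \<and> positive_semidefinite_kernel G"

definition eigenspace :: "(real \<times> real \<Rightarrow> real) \<Rightarrow> real \<Rightarrow> (real \<Rightarrow> real) set"
  where "eigenspace G \<mu> =
    {f \<in> L2_unit. AE x in unit_measure. integral_operator G f x = \<mu> * f x}"

text \<open>
  The multiplicity of \<open>\<mu>\<close> is the dimension of the eigenspace as a subspace of \<open>L\<^sub>2[0,1]\<close>, i.e. linear
  independence is taken modulo null sets. It is 0 if \<open>\<mu>\<close> is not an eigenvalue.
\<close>

definition eigenvalue_multiplicity :: "(real \<times> real \<Rightarrow> real) \<Rightarrow> real \<Rightarrow> enat"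
  where "eigenvalue_multiplicity G \<mu> = Sup {enat n | n. \<exists>f.
    (\<forall>i<n. f i \<in> eigenspace G \<mu>) \<and>
    (\<forall>c. (AE x in unit_measure. (\<Sum>i<n. c i * f i x) = 0) \<longrightarrow> (\<forall>i<n. c i = 0))}"

text \<open>
  Sequences are indexed from 1. All positive eigenvalues are listed in nonincreasing order and
  repeated according to multiplicity, so \<open>lam k > 0\<close> says that there are at least \<open>k\<close> positive
  eigenvalues and \<open>lam k\<close> is the \<open>k\<close>-th largest. If there are only finitely many, the remaining
  terms are nonpositive but otherwise arbitrary: for an indefinite kernel the eigenvalues need not
  admit a complete listing in nonincreasing order.
\<close>

definition lists_positive_eigenvalues :: "(real \<times> real \<Rightarrow> real) \<Rightarrow> (nat \<Rightarrow> real) \<Rightarrow> bool"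
  where "lists_positive_eigenvalues G lam \<longleftrightarrow>
    antimono_on {1..} lam \<and>
    (\<forall>\<mu>>0. finite {j \<in> {1..}. lam j = \<mu>} \<and>
            enat (card {j \<in> {1..}. lam j = \<mu>}) = eigenvalue_multiplicity G \<mu>)"

text \<open>
  The last conjunct selects the continuous version of an eigenfunction for a nonzero eigenvalue.
\<close>

definition orthonormal_eigenfunctions ::
    "(real \<times> real \<Rightarrow> real) \<Rightarrow> nat set \<Rightarrow> (nat \<Rightarrow> real) \<Rightarrow> (nat \<Rightarrow> real \<Rightarrow> real) \<Rightarrow> bool"
  where "orthonormal_eigenfunctions G J lam \<phi> \<longleftrightarrow>
    (\<forall>j\<in>J. \<phi> j \<in> eigenspace G (lam j)) \<and>
    (\<forall>i\<in>J. \<forall>j\<in>J. L2_inner (\<phi> i) (\<phi> j) = (if i = j then 1 else 0)) \<and>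
    (\<forall>j\<in>J. lam j \<noteq> 0 \<longrightarrow> continuous_on {0..1} (\<phi> j))"

definition spectral_gap :: "(nat \<Rightarrow> real) \<Rightarrow> nat \<Rightarrow> real"
  where "spectral_gap lam k =
    (if k = 1 then lam 1 - lam 2
     else min (lam (k - 1) - lam k) (lam k - lam (k + 1)))"

definition sup_norm :: "'a set \<Rightarrow> ('a \<Rightarrow> real) \<Rightarrow> real"
  where "sup_norm S f = (SUP x\<in>S. \<bar>f x\<bar>)"

end

(*
  Inserting the eigenvalue equations for both eigenfunctions gives, with T and S the operators of
  the two kernels,
    \<phi>h - c \<phi> = (S - T) \<phi>h / lamh + (1 / lamh - 1 / lam) T \<phi>h + T (\<phi>h - c \<phi>) / lam,
  and an operator with kernel G maps the L2 unit ball into the sup-norm ball of radius sup |G|.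
  So it remains to bound |lamh - lam| by Weyl's inequality and the L2 norm of \<phi>h - c \<phi> by the
  Davis-Kahan inequality in the form that involves only the spectral gap of T.

  Only eigenfunctions for positive eigenvalues, hence continuous ones, occur in these arguments.
  They therefore take place in C[0,1] with the L2 inner product, an incomplete inner product space
  in which the operators are still compact by the Arzela-Ascoli theorem.
*)
theory Submission
  imports Defs "HOL-Complex_Analysis.Great_Picard"
begin

section \<open>Top eigenvectors of compact self-adjoint operators\<close>

section \<open>Compact self-adjoint operators\<close>

text \<open>Compactness is sequential and puts the limit into the space itself: completeness is not
  assumed, so a Cauchy subsequence of images would not be enough.\<close>

locale compact_selfadjoint = bounded_linear T for T :: "'a::real_inner \<Rightarrow> 'a" +
  assumes selfadjoint: "inner (T x) y = inner x (T y)"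
    and compact_seq:
      "(\<And>n. norm (u n) \<le> 1) \<Longrightarrow> \<exists>g r. strict_mono (r :: nat \<Rightarrow> nat) \<and> (\<lambda>n. T (u (r n))) \<longlonglongrightarrow> g"
begin

text \<open>\<open>A = M - T\<close> is a nonnegative form on the invariant subspace
  \<open>V\<close>. Evaluating it at \<open>x - t A x\<close>, which stays in \<open>V\<close>,
  shows that a small value of the form at \<open>x\<close> forces \<open>A x\<close> itself to be
  small. For near-maximizers of the Rayleigh quotient this yields approximate eigenvectors.\<close>

lemma positive_form_norm_le:
  assumes V: "subspace V" "\<And>x. x \<in> V \<Longrightarrow> T x \<in> V"
    and pos: "\<And>x. x \<in> V \<Longrightarrow> inner (T x) x \<le> M * (norm x)\<^sup>2"
    and C: "0 < C" "\<And>x. norm (M *\<^sub>R x - T x) \<le> C * norm x"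
    and x: "x \<in> V"
  shows "(norm (M *\<^sub>R x - T x))\<^sup>2 \<le> C * (M * (norm x)\<^sup>2 - inner (T x) x)"
proof -
  define A where "A y = M *\<^sub>R y - T y" for y
  \<comment> \<open>This \<open>t\<close> minimizes the upper bound
    \<open>- 2 t |A x|^2 + t^2 C |A x|^2\<close> that appears below.\<close>
  define t where "t = 1 / C"
  have AV: "A y \<in> V" if "y \<in> V" for y
    unfolding A_def using V that by (simp add: subspace_diff subspace_scale)
  have Aself: "inner (A y) z = inner y (A z)" for y z
    by (simp add: A_def inner_diff selfadjoint)
  have Apos: "0 \<le> inner (A y) y" if "y \<in> V" for y
    using pos[OF that] by (simp add: A_def inner_diff power2_norm_eq_inner)
  have Adiff: "A (y - s *\<^sub>R z) = A y - s *\<^sub>R A z" for y z s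
    by (simp add: A_def diff scaleR algebra_simps)
  have AA: "inner (A (A x)) (A x) \<le> C * (norm (A x))\<^sup>2"
    using norm_cauchy_schwarz[of "A (A x)" "A x"] C(2)[of "A x"]
    by (smt (verit) A_def mult.assoc mult_right_mono norm_ge_zero power2_eq_square)
  have "0 \<le> inner (A (x - t *\<^sub>R A x)) (x - t *\<^sub>R A x)"
    using Apos V(1) x AV by (simp add: subspace_diff subspace_scale)
  also have "\<dots> = inner (A x) x - 2 * t * (norm (A x))\<^sup>2 + t\<^sup>2 * inner (A (A x)) (A x)"
    using Aself[of "A x" x]
    by (simp add: Adiff inner_diff dot_square_norm algebra_simps power2_eq_square)
  also have "\<dots> \<le> inner (A x) x - 2 * t * (norm (A x))\<^sup>2 + t\<^sup>2 * (C * (norm (A x))\<^sup>2)"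
    using AA by (intro add_left_mono mult_left_mono) auto
  also have "t\<^sup>2 * (C * (norm (A x))\<^sup>2) = t * (norm (A x))\<^sup>2"
    using C(1) by (simp add: t_def power2_eq_square)
  finally have "t * (norm (A x))\<^sup>2 \<le> inner (A x) x" by simp
  then have "(norm (A x))\<^sup>2 \<le> C * inner (A x) x"
    using C(1) by (simp add: t_def field_simps)
  then show ?thesis
    by (simp add: A_def inner_diff power2_norm_eq_inner)
qed

text \<open>
  A maximizing sequence \<open>u\<close> of the Rayleigh quotient satisfies \<open>(M - T) u \<rightarrow> 0\<close> by the previous
  lemma. As \<open>T u\<close> converges along a subsequence and \<open>M > 0\<close>, so does \<open>u\<close> itself, and no
  completeness is needed.
\<close>

lemma obtain_top_eigenvector:
  assumes V: "subspace V" "closed V" "\<And>x. x \<in> V \<Longrightarrow> T x \<in> V"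
    and c: "0 \<le> c" and x0: "x0 \<in> V" "c * (norm x0)\<^sup>2 < inner (T x0) x0"
  obtains \<mu> x where "c < \<mu>" "x \<in> V" "norm x = 1" "T x = \<mu> *\<^sub>R x"
proof -
  define Q where "Q = {inner (T x) x |x. x \<in> V \<and> norm x = 1}"
  define M where "M = Sup Q"
  obtain B where B: "0 < B" "\<And>x. norm (T x) \<le> norm x * B"
    using pos_bounded by blast
  have x0_nz: "x0 \<noteq> 0"
    using x0(2) by (auto simp: zero)
  \<comment> \<open>The normalized \<open>x0\<close> shows that \<open>Q\<close> is nonempty and
    that its supremum \<open>M\<close> exceeds \<open>c\<close>. Hence \<open>M > 0\<close>, which
    permits the later division by \<open>M\<close>.\<close>
  define e where "e = x0 /\<^sub>R norm x0"
  have e: "e \<in> V" "norm e = 1"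
    using x0 x0_nz V(1) by (auto simp: e_def subspace_scale)
  have "inner (T e) e = inner (T x0) x0 / (norm x0)\<^sup>2"
    using x0_nz by (simp add: e_def scaleR power2_eq_square divide_simps)
  then have ce: "c < inner (T e) e"
    using x0(2) x0_nz by (simp add: pos_less_divide_eq)
  have eQ: "inner (T e) e \<in> Q"
    using e by (auto simp: Q_def)
  have "bdd_above Q"
  proof (rule bdd_aboveI)
    fix q assume "q \<in> Q"
    then obtain x where "norm x = 1" "q = inner (T x) x" by (auto simp: Q_def)
    then show "q \<le> B" using norm_cauchy_schwarz[of "T x" x] B(2)[of x] by simp
  qed
  then have Mub: "q \<le> M" if "q \<in> Q" for q
    using that by (simp add: M_def cSup_upper)
  have M: "c < M"
    using Mub[OF eQ] ce by simp
  have form: "inner (T x) x \<le> M * (norm x)\<^sup>2" if "x \<in> V" for x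
  proof (cases "x = 0")
    case False
    have "inner (T (x /\<^sub>R norm x)) (x /\<^sub>R norm x) \<in> Q"
      using False that V(1) unfolding Q_def
      by (intro CollectI exI[of _ "x /\<^sub>R norm x"]) (auto simp: subspace_scale)
    from Mub[OF this] False show ?thesis
      by (simp add: scaleR power2_eq_square divide_simps)
  qed (simp add: zero)
  have "\<exists>x. x \<in> V \<and> norm x = 1 \<and> M - 1 / real (Suc n) < inner (T x) x" for n
  proof -
    have "M - 1 / real (Suc n) < Sup Q" by (simp add: M_def)
    then obtain q where "q \<in> Q" "M - 1 / real (Suc n) < q"
      using less_cSupE eQ by (metis empty_iff)
    then show ?thesis by (auto simp: Q_def)
  qed
  then obtain u where u: "\<And>n. u n \<in> V" "\<And>n. norm (u n) = 1"
      "\<And>n. M - 1 / real (Suc n) < inner (T (u n)) (u n)"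
    by metis
  obtain g r where r: "strict_mono (r :: nat \<Rightarrow> nat)" and g: "(\<lambda>n. T (u (r n))) \<longlonglongrightarrow> g"
    using compact_seq[of u] u(2) by force
  have C: "norm (M *\<^sub>R x - T x) \<le> (M + B) * norm x" for x
    using norm_triangle_ineq4[of "M *\<^sub>R x" "T x"] B(2)[of x] M c by (simp add: algebra_simps)
  have MB: "0 < M + B" using M c B(1) by simp
  have res: "(norm (M *\<^sub>R u n - T (u n)))\<^sup>2 \<le> (M + B) * (1 / real (Suc n))" for n
  proof -
    have "(norm (M *\<^sub>R u n - T (u n)))\<^sup>2 \<le> (M + B) * (M * (norm (u n))\<^sup>2 - inner (T (u n)) (u n))"
      by (rule positive_form_norm_le[OF V(1) V(3) form MB C u(1)])
    also have "\<dots> \<le> (M + B) * (1 / real (Suc n))"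
      using u(2,3)[of n] MB by (intro mult_left_mono) auto
    finally show ?thesis .
  qed
  have "(\<lambda>n. (norm (M *\<^sub>R u n - T (u n)))\<^sup>2) \<longlonglongrightarrow> 0"
  proof (rule tendsto_sandwich[OF _ _ tendsto_const])
    show "(\<lambda>n. (M + B) * (1 / real (Suc n))) \<longlonglongrightarrow> 0"
      using tendsto_mult[OF tendsto_const LIMSEQ_inverse_real_of_nat, of "M + B"]
      by (simp add: inverse_eq_divide)
  qed (use res in \<open>auto intro!: always_eventually\<close>)
  from tendsto_real_sqrt[OF this] have "(\<lambda>n. M *\<^sub>R u n - T (u n)) \<longlonglongrightarrow> 0"
    by (simp add: tendsto_norm_zero_iff)
  from LIMSEQ_subseq_LIMSEQ[OF this r] have "(\<lambda>n. M *\<^sub>R u (r n) - T (u (r n))) \<longlonglongrightarrow> 0"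
    by (simp add: o_def)
  from tendsto_add[OF this g] have "(\<lambda>n. M *\<^sub>R u (r n)) \<longlonglongrightarrow> g" by simp
  from tendsto_scaleR[OF tendsto_const this, of "1 / M"]
  have lim: "(\<lambda>n. u (r n)) \<longlonglongrightarrow> (1 / M) *\<^sub>R g"
    using M c by simp
  define x where "x = (1 / M) *\<^sub>R g"
  have "(\<lambda>n. T (u (r n))) \<longlonglongrightarrow> T x"
    using tendsto[OF lim] by (simp add: x_def)
  from LIMSEQ_unique[OF g this] have "T x = M *\<^sub>R x"
    using M c by (simp add: x_def)
  moreover have "norm x = 1"
    using tendsto_norm[OF lim] by (simp add: u(2) LIMSEQ_const_iff flip: x_def)
  moreover have "x \<in> V"
    using closed_sequentially[OF V(2) _ lim] u(1) by (simp add: x_def)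
  ultimately show thesis using that M by blast
qed

end

section \<open>Min-max bounds and the spectral gap for a list of eigenvalues\<close>

text \<open>
  The assumption \<open>complete\<close> says that the list misses no positive eigenvalue, counted with
  multiplicity.
\<close>

locale eigenlist = compact_selfadjoint T for T :: "'a::real_inner \<Rightarrow> 'a" +
  fixes lam :: "nat \<Rightarrow> real" and \<phi> :: "nat \<Rightarrow> 'a"
  assumes lam_antimono: "antimono_on {1..} lam"
    and eigen: "\<And>j. 1 \<le> j \<Longrightarrow> 0 < lam j \<Longrightarrow> T (\<phi> j) = lam j *\<^sub>R \<phi> j"
    and orthonormal: "\<And>i j. 1 \<le> i \<Longrightarrow> 1 \<le> j \<Longrightarrow> 0 < lam i \<Longrightarrow> 0 < lam j
      \<Longrightarrow> inner (\<phi> i) (\<phi> j) = (if i = j then 1 else 0)"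
    and complete: "\<And>\<mu> w. 0 < \<mu> \<Longrightarrow> T w = \<mu> *\<^sub>R w
      \<Longrightarrow> (\<And>j. 1 \<le> j \<Longrightarrow> lam j = \<mu> \<Longrightarrow> inner w (\<phi> j) = 0) \<Longrightarrow> w = 0"
begin

lemma lam_mono: "1 \<le> i \<Longrightarrow> i \<le> j \<Longrightarrow> lam j \<le> lam i"
  using lam_antimono by (auto simp: monotone_on_def)

text \<open>Upper half of the min-max principle. If the bound failed, the invariant complement of
  the first \<open>m - 1\<close> eigenvectors would contain an eigenvector with eigenvalue \<mu> >
  \<open>c\<close> \<ge> \<open>lam m\<close>. By monotonicity \<mu> occurs in the list only before
  position \<open>m\<close>, so this eigenvector is orthogonal to all listed ones for \<mu>, against
  \<open>complete\<close>. The bound \<open>c\<close> is nonnegative because the list accounts for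
  positive eigenvalues only.\<close>

lemma rayleigh_le:
  assumes pos: "\<And>j. 1 \<le> j \<Longrightarrow> j < m \<Longrightarrow> 0 < lam j" and m: "1 \<le> m"
    and c: "0 \<le> c" "lam m \<le> c"
    and w: "\<And>j. 1 \<le> j \<Longrightarrow> j < m \<Longrightarrow> inner w (\<phi> j) = 0"
  shows "inner (T w) w \<le> c * (norm w)\<^sup>2"
proof (rule ccontr)
  define V where "V = (\<Inter>j\<in>{1..<m}. {x. inner x (\<phi> j) = 0})"
  assume "\<not> ?thesis"
  then have wc: "c * (norm w)\<^sup>2 < inner (T w) w" by simp
  have V: "subspace V" "closed V"
    unfolding V_def
    by (auto simp: subspace_def inner_add_left intro!: closed_INT closed_Collect_eq continuous_intros)
  have TV: "T x \<in> V" if "x \<in> V" for x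
    using that pos by (auto simp: V_def selfadjoint eigen)
  have wV: "w \<in> V" using w by (auto simp: V_def)
  obtain \<mu> x where x: "c < \<mu>" "x \<in> V" "norm x = 1" "T x = \<mu> *\<^sub>R x"
    using obtain_top_eigenvector[OF V TV c(1) wV wc] .
  have "x = 0"
  proof (rule complete[OF _ x(4)])
    fix j assume j: "1 \<le> j" "lam j = \<mu>"
    then have "j < m"
      using lam_mono[of m j] m c(2) x(1) by (cases "j < m") auto
    then show "inner x (\<phi> j) = 0" using x(2) j by (auto simp: V_def)
  qed (use x c in auto)
  with x(3) show False by simp
qed

lemma span_expansion:
  assumes pos: "\<And>j. j \<in> {1..k} \<Longrightarrow> 0 < lam j" and x: "x \<in> span (\<phi> ` {1..k})"
  shows "x = (\<Sum>j=1..k. inner x (\<phi> j) *\<^sub>R \<phi> j)"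
  using x
proof (induction rule: span_induct_alt)
  case base
  show ?case by simp
next
  case (step c y z)
  then obtain i where i: "i \<in> {1..k}" "y = \<phi> i" by auto
  have "(\<Sum>j=1..k. inner (c *\<^sub>R y) (\<phi> j) *\<^sub>R \<phi> j) = (\<Sum>j=1..k. if i = j then c *\<^sub>R \<phi> j else 0)"
    using i pos by (intro sum.cong) (auto simp: orthonormal)
  also have "\<dots> = c *\<^sub>R y" using i by simp
  finally show ?case
    using step.IH by (simp add: inner_add_left scaleR_add_left sum.distrib del: inner_scaleR_left)
qed

lemma inner_sum_orthonormal:
  assumes "finite I" "\<And>j. j \<in> I \<Longrightarrow> 1 \<le> j \<and> 0 < lam j"
  shows "inner (\<Sum>j\<in>I. a j *\<^sub>R \<phi> j) (\<Sum>j\<in>I. b j *\<^sub>R \<phi> j) = (\<Sum>j\<in>I. a j * b j)"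
proof -
  have "inner (\<Sum>j\<in>I. a j *\<^sub>R \<phi> j) (\<Sum>j\<in>I. b j *\<^sub>R \<phi> j)
    = (\<Sum>i\<in>I. \<Sum>j\<in>I. a i * b j * inner (\<phi> i) (\<phi> j))"
    by (simp add: inner_sum_left inner_sum_right sum_distrib_left mult_ac)
      (subst sum.swap, simp add: inner_commute mult_ac)
  also have "\<dots> = (\<Sum>i\<in>I. \<Sum>j\<in>I. if i = j then a i * b j else 0)"
    using assms by (intro sum.cong refl) (auto simp: orthonormal)
  also have "\<dots> = (\<Sum>i\<in>I. a i * b i)" using assms(1) by simp
  finally show ?thesis .
qed

text \<open>Lower half of the min-max principle: on this span T is diagonal in an orthonormal basis,
  with entries \<open>lam j\<close> \<ge> \<open>lam k\<close>.\<close>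

lemma rayleigh_ge:
  assumes k: "1 \<le> k" "0 < lam k" and x: "x \<in> span (\<phi> ` {1..k})"
  shows "lam k * (norm x)\<^sup>2 \<le> inner (T x) x"
proof -
  have pos: "1 \<le> j \<and> 0 < lam j" if "j \<in> {1..k}" for j
    using lam_mono[of j k] k(2) that by force
  define a where "a j = inner x (\<phi> j)" for j
  have xe: "x = (\<Sum>j=1..k. a j *\<^sub>R \<phi> j)"
    unfolding a_def using span_expansion[OF _ x] pos by blast
  have Tx: "T x = (\<Sum>j=1..k. (lam j * a j) *\<^sub>R \<phi> j)"
    by (subst xe) (use pos in \<open>auto simp: sum scaleR eigen mult_ac intro!: sum.cong\<close>)
  have "lam k * (norm x)\<^sup>2 = (\<Sum>j=1..k. lam k * (a j * a j))"
    using inner_sum_orthonormal[of "{1..k}" a a] pos xe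
    by (simp add: power2_norm_eq_inner sum_distrib_left)
  also have "\<dots> \<le> (\<Sum>j=1..k. lam j * (a j * a j))"
    using lam_mono k by (intro sum_mono mult_right_mono) auto
  also have "\<dots> = inner (T x) x"
    using inner_sum_orthonormal[of "{1..k}" "\<lambda>j. lam j * a j" a] pos xe Tx by (simp add: mult_ac)
  finally show ?thesis .
qed

text \<open>Dimension count: \<open>k - 1\<close> linear conditions cannot cut a
  \<open>k\<close>-dimensional span down to zero. With \<psi> the eigenvectors of a second operator,
  the resulting vector is a test vector for both halves of the min-max principle.\<close>

lemma obtain_span_orthogonal:
  fixes \<psi> :: "nat \<Rightarrow> 'a"
  assumes k: "1 \<le> k" "0 < lam k"
  obtains u where "u \<in> span (\<phi> ` {1..k})" "u \<noteq> 0" "\<And>j. 1 \<le> j \<Longrightarrow> j < k \<Longrightarrow> inner u (\<psi> j) = 0"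
proof -
  have pos: "1 \<le> j \<and> 0 < lam j" if "j \<in> {1..k}" for j
    using lam_mono[of j k] k(2) that by force
  have inj: "inj_on \<phi> {1..k}"
    by (metis (mono_tags, lifting) inj_onI orthonormal pos zero_neq_one)
  have ind: "independent (\<phi> ` {1..k})"
  proof (rule pairwise_orthogonal_independent)
    show "pairwise orthogonal (\<phi> ` {1..k})"
      using pos by (auto simp: pairwise_def orthogonal_def orthonormal)
    show "0 \<notin> \<phi> ` {1..k}"
      using pos orthonormal by (metis (no_types, lifting) imageE inner_zero_left zero_neq_one)
  qed
  \<comment> \<open>The \<open>k - 1\<close> functionals become the coordinates of one linear map
    into the span of \<open>k - 1\<close> of the orthonormal vectors. Its kernel is the common
    kernel of the functionals, and it cannot be injective on a space of dimension
    \<open>k\<close>.\<close>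
  define P where "P x = (\<Sum>j\<in>{1..<k}. inner x (\<psi> j) *\<^sub>R \<phi> j)" for x
  have linP: "linear P"
    by (intro linearI)
      (simp_all add: P_def inner_add_left scaleR_add_left sum.distrib scaleR_sum_right)
  have P0: "inner x (\<psi> i) = 0" if "P x = 0" "i \<in> {1..<k}" for x i
  proof -
    have "0 = inner (P x) (\<phi> i)" using that by simp
    also have "\<dots> = (\<Sum>j\<in>{1..<k}. if j = i then inner x (\<psi> j) else 0)"
      unfolding P_def inner_sum_left using that pos by (intro sum.cong) (auto simp: orthonormal)
    finally show ?thesis using that by simp
  qed
  have "\<not> inj_on P (span (\<phi> ` {1..k}))"
  proof
    assume injP: "inj_on P (span (\<phi> ` {1..k}))"
    have "independent (P ` \<phi> ` {1..k})"
      by (rule linear_independent_injective_image[OF linP ind injP])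
    moreover have "P ` \<phi> ` {1..k} \<subseteq> span (\<phi> ` {1..<k})"
      unfolding P_def by (intro image_subsetI span_sum span_scale span_base) auto
    ultimately have "card (P ` \<phi> ` {1..k}) \<le> card (\<phi> ` {1..<k})"
      using independent_span_bound by (metis finite_imageI finite_atLeastLessThan)
    moreover have "card (P ` \<phi> ` {1..k}) = k"
      using inj injP by (simp add: card_image inj_on_subset span_superset)
    moreover have "card (\<phi> ` {1..<k}) \<le> k - 1"
      using card_image_le[of "{1..<k}" \<phi>] by simp
    ultimately show False using k(1) by simp
  qed
  then obtain u where "u \<in> span (\<phi> ` {1..k})" "P u = 0" "u \<noteq> 0"
    using linear_injective_on_subspace_0[OF linP subspace_span] by blast
  then show thesis using that P0 by simp
qed

text \<open>\<open>T - lam k\<close> is bounded below by \<delta> off the direction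
  \<open>\<phi> k\<close>: on earlier eigenvectors it multiplies by \<open>lam j - lam k\<close>
  \<ge> \<delta>, and on the complement of the first \<open>k\<close> its form is at most -\<delta>
  times the squared norm. The images of both components are orthogonal, so the squared estimates add
  up. \<open>next_nonneg\<close> allows \<open>lam (Suc k)\<close> as the bound \<open>c\<close> in
  \<open>rayleigh_le\<close>.\<close>

lemma norm_ge_spectral_gap:
  assumes k: "1 \<le> k" "0 < lam k" and next_nonneg: "0 \<le> lam (Suc k)"
    and \<delta>: "0 \<le> \<delta>" "\<delta> \<le> lam k - lam (Suc k)" "2 \<le> k \<Longrightarrow> \<delta> \<le> lam (k - 1) - lam k"
  shows "\<delta> * norm (u - inner u (\<phi> k) *\<^sub>R \<phi> k) \<le> norm (T u - lam k *\<^sub>R u)"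
proof -
  define A where "A x = T x - lam k *\<^sub>R x" for x
  define a where "a j = inner u (\<phi> j)" for j
  define s where "s = (\<Sum>j\<in>{1..<k}. a j *\<^sub>R \<phi> j)"
  \<comment> \<open>Orthogonal splitting of \<open>u\<close> into the component along
    \<open>\<phi> k\<close>, the part \<open>s\<close> in the earlier eigendirections (zero if
    \<open>k = 1\<close>) and the remainder \<open>w\<close>.\<close>
  define w where "w = u - a k *\<^sub>R \<phi> k - s"
  have pos: "1 \<le> j \<and> 0 < lam j" if "j \<in> {1..k}" for j
    using lam_mono[of j k] k(2) that by force
  have A_eigen: "A (\<phi> j) = (lam j - lam k) *\<^sub>R \<phi> j" if "j \<in> {1..k}" for j
    using pos[OF that] by (simp add: A_def eigen algebra_simps)
  have Alin: "A (x + y) = A x + A y" "A (c *\<^sub>R x) = c *\<^sub>R A x" "inner (A x) y = inner x (A y)" for x y c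
    by (simp_all add: A_def add scaleR algebra_simps selfadjoint)
  have s_inner: "inner s (\<phi> i) = (if i < k then a i else 0)" if "i \<in> {1..k}" for i
  proof -
    have "inner s (\<phi> i) = (\<Sum>j\<in>{1..<k}. if j = i then a j else 0)"
      unfolding s_def inner_sum_left using that pos by (intro sum.cong) (auto simp: orthonormal)
    then show ?thesis using that by auto
  qed
  have w_inner: "inner w (\<phi> i) = 0" if "i \<in> {1..k}" for i
    using that s_inner[OF that] pos[of i] pos[of k] k by (auto simp: w_def a_def inner_diff_left orthonormal)
  have ws: "inner w s = 0"
    unfolding s_def inner_sum_right using w_inner by (intro sum.neutral) auto
  have As: "A s = (\<Sum>j\<in>{1..<k}. ((lam j - lam k) * a j) *\<^sub>R \<phi> j)"
    using pos by (auto simp: A_def s_def sum scaleR eigen scaleR_sum_right sum_subtractf[symmetric]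
        algebra_simps intro!: sum.cong)
  \<comment> \<open>\<open>A s\<close> lies in the span of the earlier eigenvectors. By
    self-adjointness \<open>A w\<close> is orthogonal to each of them, as \<open>w\<close>
    is.\<close>
  have sAw: "inner (A s) (A w) = 0"
    unfolding As inner_sum_left
  proof (intro sum.neutral ballI)
    fix j assume j: "j \<in> {1..<k}"
    then have "inner (\<phi> j) (A w) = (lam j - lam k) * inner w (\<phi> j)"
      using A_eigen[of j] Alin(3)[of "\<phi> j" w] by (simp add: inner_commute)
    then show "inner (((lam j - lam k) * a j) *\<^sub>R \<phi> j) (A w) = 0"
      using w_inner[of j] j by simp
  qed
  have "(norm s)\<^sup>2 = (\<Sum>j\<in>{1..<k}. (a j)\<^sup>2)"
    unfolding power2_norm_eq_inner s_def
    using inner_sum_orthonormal[of "{1..<k}" a a] pos by (simp add: power2_eq_square)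
  then have "\<delta>\<^sup>2 * (norm s)\<^sup>2 = (\<Sum>j\<in>{1..<k}. \<delta>\<^sup>2 * (a j)\<^sup>2)"
    by (simp add: sum_distrib_left)
  also have "\<dots> \<le> (\<Sum>j\<in>{1..<k}. (lam j - lam k)\<^sup>2 * (a j)\<^sup>2)"
  proof (intro sum_mono mult_right_mono power_mono \<delta>(1))
    fix j assume "j \<in> {1..<k}"
    then have "2 \<le> k" "lam (k - 1) \<le> lam j" by (auto intro!: lam_mono)
    then show "\<delta> \<le> lam j - lam k" using \<delta>(3) by simp
  qed simp
  also have "\<dots> = (norm (A s))\<^sup>2"
    unfolding power2_norm_eq_inner As by (subst inner_sum_orthonormal)
      (use pos in \<open>auto simp: power2_eq_square mult_ac\<close>)
  finally have le_s: "\<delta>\<^sup>2 * (norm s)\<^sup>2 \<le> (norm (A s))\<^sup>2" .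
  \<comment> \<open>The index is \<open>Suc k\<close> because \<open>w\<close> is orthogonal to the
    first \<open>k\<close> eigenvectors. The form bound that follows becomes a norm bound by
    Cauchy-Schwarz and cancellation of \<open>norm w\<close>.\<close>
  have "inner (T w) w \<le> lam (Suc k) * (norm w)\<^sup>2"
    using pos w_inner next_nonneg by (intro rayleigh_le[of "Suc k"]) auto
  then have "\<delta> * (norm w)\<^sup>2 \<le> - inner (A w) w"
    using mult_right_mono[OF \<delta>(2), of "(norm w)\<^sup>2"]
    by (simp add: A_def inner_diff_left power2_norm_eq_inner algebra_simps)
  also have "\<dots> \<le> norm (A w) * norm w"
    using norm_cauchy_schwarz[of "- A w" w] by simp
  finally have "\<delta> * norm w \<le> norm (A w)"
    by (cases "w = 0") (auto simp: power2_eq_square)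
  then have le_w: "\<delta>\<^sup>2 * (norm w)\<^sup>2 \<le> (norm (A w))\<^sup>2"
    using \<delta>(1) by (simp add: power_mult_distrib[symmetric] power_mono)
  have "u = w + s + a k *\<^sub>R \<phi> k" by (simp add: w_def)
  then have "A u = A w + A s"
    using A_eigen[of k] k by (simp add: Alin)
  then have Au: "(norm (A u))\<^sup>2 = (norm (A w))\<^sup>2 + (norm (A s))\<^sup>2"
    using sAw by (simp add: power2_norm_eq_inner inner_add inner_commute)
  have "(norm (u - a k *\<^sub>R \<phi> k))\<^sup>2 = (norm (w + s))\<^sup>2" by (simp add: w_def)
  also have "\<dots> = (norm w)\<^sup>2 + (norm s)\<^sup>2"
    using ws by (simp add: power2_norm_eq_inner inner_add inner_commute)
  finally have "(\<delta> * norm (u - a k *\<^sub>R \<phi> k))\<^sup>2 \<le> (norm (A u))\<^sup>2"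
    using le_s le_w Au by (simp add: power_mult_distrib algebra_simps)
  then have "\<delta> * norm (u - a k *\<^sub>R \<phi> k) \<le> norm (A u)"
    by (rule power2_le_imp_le) simp
  then show ?thesis unfolding A_def a_def .
qed

end

section \<open>Weyl and Davis-Kahan inequalities\<close>

section \<open>Perturbation of eigenvalues and eigenvectors\<close>

text \<open>One vector is tested against both operators: it lies in the span of the first
  \<open>k\<close> eigenvectors of T, so its Rayleigh quotient for T is at least
  \<open>lam k\<close>, and it is orthogonal to the first \<open>k - 1\<close> eigenvectors of S, so
  its quotient for S is at most \<open>mu k\<close>. The two quotients differ by at most
  \<epsilon>.\<close>

lemma weyl_le:
  assumes "eigenlist T lam \<phi>" "eigenlist S mu \<psi>"
    and k: "1 \<le> k" "0 < lam k" "0 < mu k"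
    and \<epsilon>: "\<And>x. norm (T x - S x) \<le> \<epsilon> * norm x"
  shows "lam k \<le> mu k + \<epsilon>"
proof -
  interpret T: eigenlist T lam \<phi> by fact
  interpret S: eigenlist S mu \<psi> by fact
  obtain u where u: "u \<in> span (\<phi> ` {1..k})" "u \<noteq> 0" "\<And>j. 1 \<le> j \<Longrightarrow> j < k \<Longrightarrow> inner u (\<psi> j) = 0"
    using T.obtain_span_orthogonal[OF k(1,2)] by blast
  have pos: "0 < mu j" if "1 \<le> j" "j < k" for j
    using S.lam_mono[of j k] k(3) that by simp
  have "lam k * (norm u)\<^sup>2 \<le> inner (T u) u"
    by (rule T.rayleigh_ge[OF k(1,2) u(1)])
  also have "\<dots> = inner (S u) u + inner (T u - S u) u"
    by (simp add: inner_diff_left)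
  also have "\<dots> \<le> mu k * (norm u)\<^sup>2 + \<epsilon> * (norm u)\<^sup>2"
  proof (rule add_mono)
    show "inner (S u) u \<le> mu k * (norm u)\<^sup>2"
      using S.rayleigh_le[OF pos k(1) _ _ u(3)] k(3) by simp
    show "inner (T u - S u) u \<le> \<epsilon> * (norm u)\<^sup>2"
      using norm_cauchy_schwarz[of "T u - S u" u] mult_right_mono[OF \<epsilon>, of "norm u" u]
      by (simp add: power2_eq_square mult_ac)
  qed
  finally have "lam k * (norm u)\<^sup>2 \<le> (mu k + \<epsilon>) * (norm u)\<^sup>2"
    by (simp add: algebra_simps)
  then show ?thesis using u(2) by simp
qed

lemma weyl:
  assumes "eigenlist T lam \<phi>" "eigenlist S mu \<psi>" "1 \<le> k" "0 < lam k" "0 < mu k"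
    and "\<And>x. norm (T x - S x) \<le> \<epsilon> * norm x"
  shows "\<bar>lam k - mu k\<bar> \<le> \<epsilon>"
proof -
  have "lam k \<le> mu k + \<epsilon>" by (rule weyl_le) fact+
  moreover have "norm (S x - T x) \<le> \<epsilon> * norm x" for x
    using assms(6)[of x] by (simp only: norm_minus_commute)
  then have "mu k \<le> lam k + \<epsilon>" by (rule weyl_le[OF assms(2,1,3,5,4)])
  ultimately show ?thesis by linarith
qed

text \<open>With \<open>c = inner u v\<close> \<noteq> 0 the squared distances are
  \<open>2 - 2 |c|\<close> and \<open>1 - c^2\<close>, and \<open>c^2\<close> \<le>
  \<open>|c|\<close> since \<open>|c|\<close> \<le> 1. If \<open>c = 0\<close>, then
  \<open>sgn c = 0\<close> and both distances equal 1.\<close>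

lemma norm_diff_sgn_le:
  fixes u v :: "'a::real_inner"
  assumes "norm u = 1" "norm v = 1"
  shows "norm (u - sgn (inner u v) *\<^sub>R v) \<le> sqrt 2 * norm (u - inner u v *\<^sub>R v)"
proof (rule power2_le_imp_le)
  define c where "c = inner u v"
  have uv: "inner u u = 1" "inner v v = 1" "inner v u = c"
    using assms by (auto simp: norm_eq_sqrt_inner c_def inner_commute)
  have "\<bar>c\<bar> \<le> 1"
    using Cauchy_Schwarz_ineq2[of u v] assms by (simp add: c_def)
  then have bound: "1 - 2 * c * sgn c + (sgn c)\<^sup>2 \<le> 2 * (1 - c\<^sup>2)"
  proof (cases "c = 0")
    case False
    then have "1 - 2 * c * sgn c + (sgn c)\<^sup>2 = 2 - 2 * \<bar>c\<bar>"
      by (auto simp: sgn_if)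
    moreover have "\<bar>c\<bar> * \<bar>c\<bar> \<le> \<bar>c\<bar>"
      by (rule mult_left_le[OF \<open>\<bar>c\<bar> \<le> 1\<close>]) simp
    ultimately show ?thesis by (simp add: power2_eq_square abs_mult_self_eq)
  qed simp
  have sq: "(norm (u - s *\<^sub>R v))\<^sup>2 = 1 - 2 * c * s + s\<^sup>2" for s
    unfolding power2_norm_eq_inner inner_diff inner_scaleR uv c_def[symmetric]
    by (simp add: power2_eq_square right_diff_distrib)
  have "(norm (u - sgn c *\<^sub>R v))\<^sup>2 \<le> 2 * (1 - c\<^sup>2)"
    by (rule ord_eq_le_trans[OF sq bound])
  also have "1 - c\<^sup>2 = (norm (u - c *\<^sub>R v))\<^sup>2"
    by (subst sq) (simp add: power2_eq_square)
  finally show "(norm (u - sgn (inner u v) *\<^sub>R v))\<^sup>2 \<le> (sqrt 2 * norm (u - inner u v *\<^sub>R v))\<^sup>2"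
    unfolding c_def[symmetric] power_mult_distrib by simp
qed simp

text \<open>The gap estimate for T bounds the distance of \<open>\<psi> k\<close> from its
  projection onto \<open>\<phi> k\<close> by the residual of \<open>\<psi> k\<close> over \<delta>.
  The residual consists of \<open>(T - S) \<psi> k\<close> and
  \<open>(mu k - lam k) \<psi> k\<close>, each of norm at most \<epsilon>, the second by Weyl; hence
  the factor 2. Replacing the projection coefficient by its sign costs
  \<open>sqrt 2\<close>.\<close>

lemma davis_kahan:
  assumes T: "eigenlist T lam \<phi>" and S: "eigenlist S mu \<psi>"
    and k: "1 \<le> k" "0 < lam k" "0 < mu k" and next_nonneg: "0 \<le> lam (Suc k)"
    and \<delta>: "0 < \<delta>" "\<delta> \<le> lam k - lam (Suc k)" "2 \<le> k \<Longrightarrow> \<delta> \<le> lam (k - 1) - lam k"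
    and \<epsilon>: "\<And>x. norm (T x - S x) \<le> \<epsilon> * norm x"
  shows "norm (\<psi> k - sgn (inner (\<psi> k) (\<phi> k)) *\<^sub>R \<phi> k) \<le> 2 * sqrt 2 * \<epsilon> / \<delta>"
proof -
  interpret T: eigenlist T lam \<phi> by fact
  interpret S: eigenlist S mu \<psi> by fact
  have unit: "norm (\<phi> k) = 1" "norm (\<psi> k) = 1"
    using T.orthonormal[of k k] S.orthonormal[of k k] k by (simp_all add: norm_eq_sqrt_inner)
  let ?x = "\<psi> k - inner (\<psi> k) (\<phi> k) *\<^sub>R \<phi> k"
  have "\<delta> * norm ?x \<le> norm (T (\<psi> k) - lam k *\<^sub>R \<psi> k)"
    using T.norm_ge_spectral_gap[OF k(1,2) next_nonneg _ \<delta>(2,3)] \<delta>(1) by simp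
  also have "T (\<psi> k) - lam k *\<^sub>R \<psi> k = (T (\<psi> k) - S (\<psi> k)) + (mu k - lam k) *\<^sub>R \<psi> k"
    using S.eigen[of k] k by (simp add: algebra_simps)
  also have "norm \<dots> \<le> \<epsilon> + \<epsilon>"
    using \<epsilon>[of "\<psi> k"] weyl[OF T S k \<epsilon>] unit
    by (intro norm_triangle_mono) (auto simp: abs_minus_commute)
  finally have "norm ?x \<le> 2 * \<epsilon> / \<delta>"
    using \<delta>(1) by (simp add: field_simps)
  then have "sqrt 2 * norm ?x \<le> sqrt 2 * (2 * \<epsilon> / \<delta>)"
    by (rule mult_left_mono) simp
  also have "\<dots> = 2 * sqrt 2 * \<epsilon> / \<delta>" by simp
  finally show ?thesis using norm_diff_sgn_le[OF unit(2,1)] by linarith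
qed

section \<open>The space C[0,1] with the L2 inner product\<close>

section \<open>Integral operators on continuous functions\<close>

text \<open>Fixing the value 0 outside the interval makes representatives unique, so that the L2
  norm is definite.\<close>

typedef cont01 = "{f :: real \<Rightarrow> real. continuous_on {0..1} f \<and> (\<forall>x. x \<notin> {0..1} \<longrightarrow> f x = 0)}"
  morphisms cfun Abs_cont01
  by (rule exI[of _ "\<lambda>_. 0"]) simp

setup_lifting type_definition_cont01

definition mk_cont01 :: "(real \<Rightarrow> real) \<Rightarrow> cont01"
  where "mk_cont01 f = Abs_cont01 (\<lambda>x. if x \<in> {0..1} then f x else 0)"

lemma continuous_cfun: "continuous_on {0..1} (cfun f)"
  using cfun by auto

lemma cfun_outside: "x \<notin> {0..1} \<Longrightarrow> cfun f x = 0"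
  using cfun by auto

lemma cfun_mk_cont01:
  assumes "continuous_on {0..1} f" "x \<in> {0..1}"
  shows "cfun (mk_cont01 f) x = f x"
proof -
  have "continuous_on {0..1} (\<lambda>x. if x \<in> {0..1} then f x else 0)"
    by (rule continuous_on_eq[OF assms(1)]) simp
  then show ?thesis
    using assms(2) by (simp add: mk_cont01_def Abs_cont01_inverse)
qed

lemma cont01_eqI: "(\<And>x. x \<in> {0..1} \<Longrightarrow> cfun f x = cfun g x) \<Longrightarrow> f = g"
  by (metis cfun_inject cfun_outside ext)

instantiation cont01 :: real_vector
begin

lift_definition zero_cont01 :: cont01 is "\<lambda>_. 0" by simp
lift_definition plus_cont01 :: "cont01 \<Rightarrow> cont01 \<Rightarrow> cont01" is "\<lambda>f g x. f x + g x"
  by (auto intro: continuous_intros)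
lift_definition minus_cont01 :: "cont01 \<Rightarrow> cont01 \<Rightarrow> cont01" is "\<lambda>f g x. f x - g x"
  by (auto intro: continuous_intros)
lift_definition uminus_cont01 :: "cont01 \<Rightarrow> cont01" is "\<lambda>f x. - f x"
  by (auto intro: continuous_intros)
lift_definition scaleR_cont01 :: "real \<Rightarrow> cont01 \<Rightarrow> cont01" is "\<lambda>c f x. c * f x"
  by (auto intro: continuous_intros)

instance
  by standard (transfer; simp add: fun_eq_iff algebra_simps)+

end

lemmas cfun_simps [simp] =
  zero_cont01.rep_eq plus_cont01.rep_eq minus_cont01.rep_eq uminus_cont01.rep_eq scaleR_cont01.rep_eq

lemma cfun_sum: "cfun (\<Sum>i\<in>I. f i) x = (\<Sum>i\<in>I. cfun (f i) x)"
  by (induction I rule: infinite_finite_induct) simp_all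

lemma integrable_unit: "continuous_on {0..1} f \<Longrightarrow> integrable unit_measure (f :: real \<Rightarrow> real)"
  by (rule continuous_imp_integrable_real)

text \<open>The square of \<open>f\<close> is continuous and nonnegative with integral zero. This
  turns the almost-everywhere identities in the definitions of eigenspace and multiplicity into
  pointwise ones.\<close>

lemma continuous_AE_zero:
  fixes f :: "real \<Rightarrow> real"
  assumes f: "continuous_on {0..1} f" and "AE x in unit_measure. f x = 0" and x: "x \<in> {0..1}"
  shows "f x = 0"
proof -
  have "integral\<^sup>L unit_measure (\<lambda>x. (f x)\<^sup>2) = 0"
    using assms(2) by (intro integral_eq_zero_AE) auto
  then have "\<forall>x\<in>{0..1}. (f x)\<^sup>2 = 0"
    using f by (subst (asm) integralL_eq_0_iff) (auto intro!: continuous_intros)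
  with x show ?thesis by simp
qed

instantiation cont01 :: real_inner
begin

definition inner_cont01 :: "cont01 \<Rightarrow> cont01 \<Rightarrow> real"
  where "inner_cont01 f g = L2_inner (cfun f) (cfun g)"
definition norm_cont01 :: "cont01 \<Rightarrow> real"
  where "norm_cont01 f = sqrt (inner f f)"
definition sgn_cont01 :: "cont01 \<Rightarrow> cont01"
  where "sgn_cont01 f = f /\<^sub>R norm f"
definition dist_cont01 :: "cont01 \<Rightarrow> cont01 \<Rightarrow> real"
  where "dist_cont01 f g = norm (f - g)"
definition uniformity_cont01 :: "(cont01 \<times> cont01) filter"
  where "uniformity_cont01 = (INF e\<in>{0<..}. principal {(f, g). dist f g < e})"
definition open_cont01 :: "cont01 set \<Rightarrow> bool"
  where "open_cont01 U \<longleftrightarrow> (\<forall>f\<in>U. \<forall>\<^sub>F (f', g) in uniformity. f' = f \<longrightarrow> g \<in> U)"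

instance
proof
  fix f g h :: cont01 and c :: real and U :: "cont01 set"
  have int: "integrable unit_measure (\<lambda>x. cfun f x * cfun g x)" for f g
    by (intro integrable_unit continuous_intros continuous_cfun)
  show "sgn f = inverse (norm f) *\<^sub>R f" by (simp add: sgn_cont01_def)
  show "dist f g = norm (f - g)" by (simp add: dist_cont01_def)
  show "uniformity = (INF e\<in>{0<..}. principal {(f::cont01, g). dist f g < e})"
    by (simp add: uniformity_cont01_def)
  show "open U \<longleftrightarrow> (\<forall>f\<in>U. \<forall>\<^sub>F (f', g) in uniformity. f' = f \<longrightarrow> g \<in> U)"
    by (simp add: open_cont01_def)
  show "inner f g = inner g f" by (simp add: inner_cont01_def L2_inner_def mult.commute)
  show "inner (f + g) h = inner f h + inner g h"
    using int by (simp add: inner_cont01_def L2_inner_def distrib_right)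
  show "inner (c *\<^sub>R f) g = c * inner f g"
    by (simp add: inner_cont01_def L2_inner_def mult.assoc)
  show "0 \<le> inner f f" by (simp add: inner_cont01_def L2_inner_def)
  show "inner f f = 0 \<longleftrightarrow> f = 0"
  proof -
    have "inner f f = 0 \<longleftrightarrow> (\<forall>x\<in>{0..1}. cfun f x * cfun f x = 0)"
      unfolding inner_cont01_def L2_inner_def
      by (intro integralL_eq_0_iff continuous_intros continuous_cfun) auto
    then show ?thesis by (auto intro: cont01_eqI)
  qed
  show "norm f = sqrt (inner f f)" by (simp add: norm_cont01_def)
qed

end

lemma inner_mk_cont01:
  assumes "continuous_on {0..1} f" "continuous_on {0..1} g"
  shows "inner (mk_cont01 f) (mk_cont01 g) = L2_inner f g"
  unfolding inner_cont01_def L2_inner_def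
  by (rule Bochner_Integration.integral_cong) (use assms in \<open>auto simp: cfun_mk_cont01\<close>)

text \<open>The interval has measure one, so the L2 norm is dominated by the sup norm.\<close>

lemma norm_cont01_le:
  assumes "\<And>x. x \<in> {0..1} \<Longrightarrow> \<bar>cfun f x\<bar> \<le> B"
  shows "norm f \<le> B"
proof -
  have B: "0 \<le> B" using assms[of 0] by simp
  have "inner f f \<le> (\<integral>x. B\<^sup>2 \<partial>unit_measure)"
    unfolding inner_cont01_def L2_inner_def
  proof (intro integral_mono integrable_unit continuous_intros continuous_cfun)
    fix x assume "x \<in> space unit_measure"
    then show "cfun f x * cfun f x \<le> B\<^sup>2"
      using assms[of x] B power_mono[of "\<bar>cfun f x\<bar>" B 2] by (simp add: power2_eq_square)
  qed
  also have "\<dots> = B\<^sup>2"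
    by (simp add: measure_restrict_space)
  finally have "(norm f)\<^sup>2 \<le> B\<^sup>2" by (simp add: power2_norm_eq_inner)
  then show ?thesis using B by (rule power2_le_imp_le)
qed

section \<open>Kernel operators: sup-norm bound, self-adjointness, compactness\<close>

definition kernel_section :: "(real \<times> real \<Rightarrow> real) \<Rightarrow> real \<Rightarrow> cont01"
  where "kernel_section G x = mk_cont01 (\<lambda>y. G (x, y))"

definition kernel_op :: "(real \<times> real \<Rightarrow> real) \<Rightarrow> cont01 \<Rightarrow> cont01"
  where "kernel_op G f = mk_cont01 (integral_operator G (cfun f))"

lemma abs_le_sup_norm:
  fixes G :: "'a::topological_space \<Rightarrow> real"
  assumes "compact S" "continuous_on S G" "p \<in> S"
  shows "\<bar>G p\<bar> \<le> sup_norm S G"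
  unfolding sup_norm_def
proof (rule cSUP_upper[OF assms(3)])
  show "bdd_above ((\<lambda>x. \<bar>G x\<bar>) ` S)"
    using assms by (intro bounded_imp_bdd_above compact_imp_bounded compact_continuous_image
        continuous_intros)
qed

lemma compact_unit_square: "compact unit_square"
  by (intro compact_Times) auto

lemma continuous_section:
  assumes "continuous_on unit_square G" "x \<in> {0..1}"
  shows "continuous_on {0..1} (\<lambda>y. G (x, y))"
  using assms(2) by (intro continuous_on_compose2[OF assms(1)] continuous_intros) auto

lemma cfun_section:
  "continuous_on unit_square G \<Longrightarrow> x \<in> {0..1} \<Longrightarrow> y \<in> {0..1} \<Longrightarrow> cfun (kernel_section G x) y = G (x, y)"
  by (simp add: kernel_section_def cfun_mk_cont01 continuous_section)

text \<open>With point values written as inner products against a row of the kernel, pointwise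
  estimates reduce to Cauchy-Schwarz.\<close>

lemma integral_operator_eq_inner:
  assumes "continuous_on unit_square G" "x \<in> {0..1}"
  shows "integral_operator G (cfun f) x = inner (kernel_section G x) f"
  unfolding inner_cont01_def L2_inner_def integral_operator_def
  by (rule Bochner_Integration.integral_cong) (use assms in \<open>auto simp: cfun_section\<close>)

lemma integral_operator_cong:
  "(\<And>y. y \<in> {0..1} \<Longrightarrow> f y = g y) \<Longrightarrow> integral_operator G f x = integral_operator G g x"
  unfolding integral_operator_def by (rule Bochner_Integration.integral_cong) auto

lemma continuous_kernel_times:
  assumes "continuous_on unit_square G"
  shows "continuous_on unit_square (\<lambda>(x, y). G (x, y) * cfun f y)"
  unfolding case_prod_beta using assms
  by (intro continuous_intros continuous_on_compose2[OF continuous_cfun]) (auto simp: continuous_intros)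

lemma integral_unit: "continuous_on {0..1} f \<Longrightarrow> integral\<^sup>L unit_measure f = integral {0..1} (f :: real \<Rightarrow> real)"
  by (simp add: lebesgue_integral_eq_integral integrable_unit)

lemma continuous_integral_operator:
  assumes "continuous_on unit_square G"
  shows "continuous_on {0..1} (integral_operator G (cfun f))"
proof -
  have "continuous_on {0..1} (\<lambda>x. integral (cbox 0 1) (\<lambda>y. G (x, y) * cfun f y))"
    by (rule integral_continuous_on_param) (use continuous_kernel_times[OF assms] in simp)
  then show ?thesis
  proof (rule continuous_on_eq)
    fix x :: real assume x: "x \<in> {0..1}"
    have "integral_operator G (cfun f) x = integral {0..1} (\<lambda>y. G (x, y) * cfun f y)"
      unfolding integral_operator_def
      by (intro integral_unit continuous_intros continuous_section[OF assms x] continuous_cfun)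
    then show "integral (cbox 0 1) (\<lambda>y. G (x, y) * cfun f y) = integral_operator G (cfun f) x"
      by simp
  qed
qed

lemma cfun_kernel_op:
  assumes "continuous_on unit_square G" "x \<in> {0..1}"
  shows "cfun (kernel_op G f) x = inner (kernel_section G x) f"
  unfolding kernel_op_def using assms
  by (simp add: cfun_mk_cont01 continuous_integral_operator integral_operator_eq_inner)

text \<open>Cauchy-Schwarz against the row at \<open>x\<close>, whose L2 norm is at most its sup
  norm. This step carries L2 estimates over to the sup norm.\<close>

lemma abs_kernel_op_le:
  assumes G: "continuous_on unit_square G" and x: "x \<in> {0..1}"
  shows "\<bar>cfun (kernel_op G f) x\<bar> \<le> sup_norm unit_square G * norm f"
proof -
  have "norm (kernel_section G x) \<le> sup_norm unit_square G"
    using x by (intro norm_cont01_le) (simp add: cfun_section[OF G] abs_le_sup_norm compact_unit_square G)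
  then have "norm (kernel_section G x) * norm f \<le> sup_norm unit_square G * norm f"
    by (intro mult_right_mono) auto
  then show ?thesis
    unfolding cfun_kernel_op[OF G x] using Cauchy_Schwarz_ineq2 order_trans by blast
qed

lemma norm_kernel_op_le:
  "continuous_on unit_square G \<Longrightarrow> norm (kernel_op G f) \<le> sup_norm unit_square G * norm f"
  by (intro norm_cont01_le abs_kernel_op_le)

lemma kernel_op_diff:
  assumes "continuous_on unit_square G" "continuous_on unit_square H"
  shows "kernel_op G f - kernel_op H f = kernel_op (\<lambda>p. G p - H p) f"
proof (rule cont01_eqI)
  fix x :: real assume x: "x \<in> {0..1}"
  have GH: "continuous_on unit_square (\<lambda>p. G p - H p)"
    using assms by (intro continuous_intros)
  have "kernel_section (\<lambda>p. G p - H p) x = kernel_section G x - kernel_section H x"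
    by (rule cont01_eqI) (simp add: cfun_section assms GH x del: atLeastAtMost_iff)
  then show "cfun (kernel_op G f - kernel_op H f) x = cfun (kernel_op (\<lambda>p. G p - H p) f) x"
    by (simp add: cfun_kernel_op assms GH x inner_diff_left del: atLeastAtMost_iff)
qed

text \<open>Both sides are iterated integrals of continuous functions over the square; exchanging
  the order of integration and using the symmetry of \<open>G\<close> identifies them.\<close>

lemma kernel_op_selfadjoint:
  assumes G: "continuous_on unit_square G" "symmetric_kernel G"
  shows "inner (kernel_op G f) g = inner f (kernel_op G g)"
proof -
  have "continuous_on unit_square (\<lambda>p. cfun g (fst p))"
    by (intro continuous_on_compose2[OF continuous_cfun] continuous_intros) auto
  from continuous_on_mult[OF continuous_kernel_times[OF G(1), of f] this]
  have cont: "continuous_on (cbox (0, 0) (1, 1)) (\<lambda>(x, y). G (x, y) * cfun f y * cfun g x)"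
    by (simp add: case_prod_beta cbox_Pair_eq)
  have expand: "inner (kernel_op G h) h' = integral {0..1} (\<lambda>x. integral {0..1} (\<lambda>y. G (x, y) * cfun h y * cfun h' x))"
    for h h'
  proof -
    have "inner (kernel_op G h) h' = integral {0..1} (\<lambda>x. cfun (kernel_op G h) x * cfun h' x)"
      unfolding inner_cont01_def L2_inner_def
      by (intro integral_unit continuous_intros continuous_cfun)
    also have "\<dots> = integral {0..1} (\<lambda>x. integral {0..1} (\<lambda>y. G (x, y) * cfun h y * cfun h' x))"
    proof (rule Henstock_Kurzweil_Integration.integral_cong)
      fix x :: real assume x: "x \<in> {0..1}"
      have "cfun (kernel_op G h) x = integral {0..1} (\<lambda>y. G (x, y) * cfun h y)"
        unfolding kernel_op_def cfun_mk_cont01[OF continuous_integral_operator[OF G(1)] x]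
          integral_operator_def
        by (intro integral_unit continuous_intros continuous_cfun continuous_section G x)
      then show "cfun (kernel_op G h) x * cfun h' x = integral {0..1} (\<lambda>y. G (x, y) * cfun h y * cfun h' x)"
        by simp
    qed
    finally show ?thesis .
  qed
  have "inner (kernel_op G f) g = integral {0..1} (\<lambda>y. integral {0..1} (\<lambda>x. G (x, y) * cfun f y * cfun g x))"
    unfolding expand using integral_swap_continuous[OF cont] by simp
  also have "\<dots> = inner (kernel_op G g) f"
    unfolding expand
    by (intro Henstock_Kurzweil_Integration.integral_cong)
      (use G(2) in \<open>auto simp: symmetric_kernel_def mult_ac\<close>)
  finally show ?thesis by (simp add: inner_commute)
qed

text \<open>The images of the unit ball are uniformly bounded and equicontinuous, so Arzela-Ascoli
  gives a uniformly convergent subsequence with continuous limit. Uniform convergence implies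
  convergence in the L2 norm.\<close>

lemma kernel_op_compact:
  assumes G: "continuous_on unit_square G" and u: "\<And>n. norm (u n) \<le> 1"
  shows "\<exists>g r. strict_mono (r :: nat \<Rightarrow> nat) \<and> (\<lambda>n. kernel_op G (u (r n))) \<longlonglongrightarrow> g"
proof -
  have bound: "norm (cfun (kernel_op G (u n)) x) \<le> sup_norm unit_square G" if "x \<in> {0..1}" for n x
  proof -
    have "0 \<le> sup_norm unit_square G"
      using abs_le_sup_norm[OF compact_unit_square G, of "(0, 0)"] by simp
    then show ?thesis
      using abs_kernel_op_le[OF G that, of "u n"] mult_left_le[OF u[of n]] by fastforce
  qed
  have equi: "\<exists>d>0. \<forall>n y. y \<in> {0..1} \<and> norm (x - y) < d
      \<longrightarrow> norm (cfun (kernel_op G (u n)) x - cfun (kernel_op G (u n)) y) < e"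
    if x: "x \<in> {0..1}" and e: "0 < e" for x e
  proof -
    have "uniformly_continuous_on unit_square G"
      by (rule compact_uniformly_continuous[OF G compact_unit_square])
    then obtain d where d: "0 < d"
      "\<And>p q. p \<in> unit_square \<Longrightarrow> q \<in> unit_square \<Longrightarrow> dist q p < d \<Longrightarrow> dist (G q) (G p) < e / 2"
      using e by (elim uniformly_continuous_onE[of _ _ "e / 2"]) auto
    have "norm (cfun (kernel_op G (u n)) x - cfun (kernel_op G (u n)) y) < e"
      if y: "y \<in> {0..1}" "norm (x - y) < d" for n y
    proof -
      \<comment> \<open>Uniform continuity of \<open>G\<close> makes nearby rows uniformly close,
        with \<open>d\<close> independent of \<open>n\<close>. The bound \<open>e / 2\<close> leaves
        room for the strict inequality after Cauchy-Schwarz with \<open>norm (u n)\<close> \<le>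
        1.\<close>
      have "norm (kernel_section G x - kernel_section G y) \<le> e / 2"
      proof (rule norm_cont01_le)
        fix z :: real assume z: "z \<in> {0..1}"
        have "dist (G (x, z)) (G (y, z)) < e / 2"
          using d(2)[of "(y, z)" "(x, z)"] x y z by (simp add: dist_Pair_Pair dist_norm)
        then show "\<bar>cfun (kernel_section G x - kernel_section G y) z\<bar> \<le> e / 2"
          using x y(1) z by (simp add: cfun_section[OF G] dist_real_def del: atLeastAtMost_iff)
      qed
      then have "norm (kernel_section G x - kernel_section G y) * norm (u n) \<le> e / 2 * 1"
        using u[of n] e by (intro mult_mono) auto
      moreover have "\<bar>inner (kernel_section G x - kernel_section G y) (u n)\<bar>
          \<le> norm (kernel_section G x - kernel_section G y) * norm (u n)"
        by (rule Cauchy_Schwarz_ineq2)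
      ultimately show ?thesis
        using x y(1) e by (simp add: cfun_kernel_op[OF G] inner_diff_left del: atLeastAtMost_iff)
    qed
    with d(1) show ?thesis by blast
  qed
  obtain g r where g: "continuous_on {0..1} g" and r: "strict_mono (r :: nat \<Rightarrow> nat)"
    and conv: "\<And>e. 0 < e \<Longrightarrow> \<exists>N. \<forall>n x. n \<ge> N \<and> x \<in> {0..1}
      \<longrightarrow> norm (cfun (kernel_op G (u (r n))) x - g x) < e"
    using Arzela_Ascoli[of "{0..1::real}" "\<lambda>n. cfun (kernel_op G (u n))", OF _ bound equi]
    by (metis compact_Icc)
  have "(\<lambda>n. kernel_op G (u (r n))) \<longlonglongrightarrow> mk_cont01 g"
  proof (rule LIMSEQ_I)
    fix e :: real assume e: "0 < e"
    obtain N where N: "\<And>n x. n \<ge> N \<Longrightarrow> x \<in> {0..1} \<Longrightarrow> \<bar>cfun (kernel_op G (u (r n))) x - g x\<bar> < e / 2"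
      using conv[of "e / 2"] e by auto
    have "norm (kernel_op G (u (r n)) - mk_cont01 g) \<le> e / 2" if "n \<ge> N" for n
      using N[OF that] by (intro norm_cont01_le) (simp add: cfun_mk_cont01[OF g] less_imp_le)
    then show "\<exists>N. \<forall>n\<ge>N. norm (kernel_op G (u (r n)) - mk_cont01 g) < e"
      using e by (intro exI[of _ N]) fastforce
  qed
  with r show ?thesis by blast
qed

lemma compact_selfadjoint_kernel_op:
  assumes G: "continuous_on unit_square G" "symmetric_kernel G"
  shows "compact_selfadjoint (kernel_op G)"
proof unfold_locales
  show "kernel_op G (f + g) = kernel_op G f + kernel_op G g" for f g
    by (rule cont01_eqI) (simp add: cfun_kernel_op[OF G(1)] inner_add_right del: atLeastAtMost_iff)
  show "kernel_op G (c *\<^sub>R f) = c *\<^sub>R kernel_op G f" for c f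
    by (rule cont01_eqI) (simp add: cfun_kernel_op[OF G(1)] del: atLeastAtMost_iff)
  show "\<exists>K. \<forall>f. norm (kernel_op G f) \<le> norm f * K"
    using norm_kernel_op_le[OF G(1)] by (metis mult.commute)
  show "inner (kernel_op G f) g = inner f (kernel_op G g)" for f g
    by (rule kernel_op_selfadjoint[OF G])
  show "\<exists>g r. strict_mono (r :: nat \<Rightarrow> nat) \<and> (\<lambda>n. kernel_op G (u (r n))) \<longlonglongrightarrow> g"
    if "\<And>n. norm (u n) \<le> 1" for u
    by (rule kernel_op_compact[OF G(1) that])
qed

section \<open>Eigenfunctions as eigenvectors in C[0,1]\<close>

lemma kernel_op_mk_eigenfunction:
  assumes G: "continuous_on unit_square G" and f: "f \<in> eigenspace G \<mu>" "continuous_on {0..1} f"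
  shows "kernel_op G (mk_cont01 f) = \<mu> *\<^sub>R mk_cont01 f"
proof (rule cont01_eqI)
  fix x :: real assume x: "x \<in> {0..1}"
  let ?g = "\<lambda>x. integral_operator G (cfun (mk_cont01 f)) x - \<mu> * f x"
  have op: "integral_operator G (cfun (mk_cont01 f)) y = integral_operator G f y" for y
    by (intro integral_operator_cong cfun_mk_cont01 f)
  \<comment> \<open>The eigenspace gives the equation only almost everywhere; as both sides are
    continuous, it extends to every point.\<close>
  have "AE x in unit_measure. ?g x = 0"
    using f(1) by (simp add: eigenspace_def op)
  then have "?g x = 0"
    by (rule continuous_AE_zero[rotated])
      (use x f in \<open>auto intro!: continuous_intros continuous_integral_operator G\<close>)
  then show "cfun (kernel_op G (mk_cont01 f)) x = cfun (\<mu> *\<^sub>R mk_cont01 f) x"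
    using x f by (simp add: kernel_op_def cfun_mk_cont01 continuous_integral_operator[OF G] del: atLeastAtMost_iff)
qed

lemma cfun_in_eigenspace:
  assumes G: "continuous_on unit_square G" and w: "kernel_op G w = \<mu> *\<^sub>R w"
  shows "cfun w \<in> eigenspace G \<mu>"
proof -
  have "cfun w \<in> L2_unit"
    unfolding L2_unit_def
    by (auto intro!: borel_measurable_integrable integrable_unit continuous_intros continuous_cfun)
  moreover have "integral_operator G (cfun w) x = \<mu> * cfun w x" if "x \<in> {0..1}" for x
    using arg_cong[OF w, of "\<lambda>f. cfun f x"] that
    by (simp add: kernel_op_def cfun_mk_cont01 continuous_integral_operator[OF G] del: atLeastAtMost_iff)
  ultimately show ?thesis
    unfolding eigenspace_def by (auto intro!: AE_I2)
qed

text \<open>The main point is \<open>complete\<close>: a nonzero eigenvector for \<mu> orthogonal to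
  the \<open>n\<close> listed ones would give \<open>n + 1\<close> independent eigenfunctions, while
  the list fixes the multiplicity of \<mu> as \<open>n\<close>.\<close>

lemma eigenlist_kernel_op:
  assumes G: "continuous_on unit_square G" "symmetric_kernel G"
    and lists: "lists_positive_eigenvalues G lam"
    and on: "orthonormal_eigenfunctions G {j \<in> {1..}. 0 < lam j} lam \<phi>"
  shows "eigenlist (kernel_op G) lam (\<lambda>j. mk_cont01 (\<phi> j))"
proof -
  interpret compact_selfadjoint "kernel_op G"
    by (rule compact_selfadjoint_kernel_op[OF G])
  have cont: "continuous_on {0..1} (\<phi> j)" and es: "\<phi> j \<in> eigenspace G (lam j)"
    if "1 \<le> j" "0 < lam j" for j
    using on that by (auto simp: orthonormal_eigenfunctions_def)
  have orth: "inner (mk_cont01 (\<phi> i)) (mk_cont01 (\<phi> j)) = (if i = j then 1 else 0)"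
    if "1 \<le> i" "1 \<le> j" "0 < lam i" "0 < lam j" for i j
    using on that by (simp add: inner_mk_cont01 cont orthonormal_eigenfunctions_def)
  have compl: "w = 0"
    if \<mu>: "0 < \<mu>" and w: "kernel_op G w = \<mu> *\<^sub>R w"
      and perp: "\<And>j. 1 \<le> j \<Longrightarrow> lam j = \<mu> \<Longrightarrow> inner w (mk_cont01 (\<phi> j)) = 0" for \<mu> w
  proof (rule ccontr)
    assume w0: "w \<noteq> 0"
    define J where "J = {j \<in> {1..}. lam j = \<mu>}"
    have J: "finite J" "enat (card J) = eigenvalue_multiplicity G \<mu>"
      using lists \<mu> by (auto simp: lists_positive_eigenvalues_def J_def)
    define n where "n = card J"
    obtain h where h: "bij_betw h {..<n} J"
      using ex_bij_betw_nat_finite[OF J(1)] by (auto simp: n_def atLeast0LessThan)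
    have hJ: "1 \<le> h i" "lam (h i) = \<mu>" if "i < n" for i
      using bij_betwE[OF h] that by (auto simp: J_def)
    \<comment> \<open>The \<open>n\<close> listed eigenvectors for \<mu>, followed by the supposed
      extra one at index \<open>n\<close>.\<close>
    define v where "v i = (if i < n then mk_cont01 (\<phi> (h i)) else w)" for i
    have vv: "inner (v i) (v j) = 0" if "i < Suc n" "j < Suc n" "i \<noteq> j" for i j
    proof -
      have "h i = h j \<longleftrightarrow> i = j" if "i < n" "j < n"
        using bij_betw_imp_inj_on[OF h] that by (auto simp: inj_on_def)
      then show ?thesis
        using that hJ \<mu> perp by (auto simp: v_def orth inner_commute less_Suc_eq)
    qed
    have vn: "v i \<noteq> 0" if "i < Suc n" for i
      using w0 orth[of "h i" "h i"] hJ[of i] \<mu> by (auto simp: v_def)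
    have "cfun (v i) \<in> eigenspace G \<mu>" for i
    proof (rule cfun_in_eigenspace[OF G(1)])
      show "kernel_op G (v i) = \<mu> *\<^sub>R v i"
        using w hJ[of i] \<mu> kernel_op_mk_eigenfunction[OF G(1) es cont] by (auto simp: v_def)
    qed
    moreover have "c i = 0"
      if ae: "AE x in unit_measure. (\<Sum>i<Suc n. c i * cfun (v i) x) = 0" and i: "i < Suc n" for c i
    proof -
      \<comment> \<open>Independence is required modulo null sets. Continuity makes the relation
        exact, and pairing it with \<open>v i\<close> isolates \<open>c i\<close>.\<close>
      have "(\<Sum>i<Suc n. c i *\<^sub>R v i) = 0"
      proof (rule cont01_eqI)
        fix x :: real assume x: "x \<in> {0..1}"
        have "(\<Sum>i<Suc n. c i * cfun (v i) x) = 0"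
          by (rule continuous_AE_zero[OF _ ae x]) (intro continuous_intros continuous_cfun)
        then show "cfun (\<Sum>i<Suc n. c i *\<^sub>R v i) x = cfun 0 x"
          by (simp add: cfun_sum)
      qed
      then have "inner (\<Sum>j<Suc n. c j *\<^sub>R v j) (v i) = 0"
        by (simp only: inner_zero_left)
      then have "0 = (\<Sum>j<Suc n. c j * inner (v j) (v i))"
        by (simp only: inner_sum_left inner_scaleR_left)
      also have "\<dots> = (\<Sum>j<Suc n. if j = i then c i * inner (v i) (v i) else 0)"
        using vv i by (intro sum.cong) auto
      also have "\<dots> = c i * inner (v i) (v i)" using i by simp
      finally show ?thesis using vn[OF i] by simp
    qed
    ultimately have "enat (Suc n) \<le> eigenvalue_multiplicity G \<mu>"
      unfolding eigenvalue_multiplicity_def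
      by (intro Sup_upper CollectI exI[of _ "Suc n"] conjI refl exI[of _ "\<lambda>i. cfun (v i)"]) auto
    then show False unfolding J(2)[symmetric] n_def by simp
  qed
  show ?thesis
  proof
    show "antimono_on {1..} lam"
      using lists by (simp add: lists_positive_eigenvalues_def)
  qed (use orth compl kernel_op_mk_eigenfunction[OF G(1) es cont] in auto)
qed

section \<open>The gap at a simple eigenvalue and the final sup-norm estimate\<close>

lemma spectral_gap_simple:
  assumes lists: "lists_positive_eigenvalues G lam"
    and k: "1 \<le> k" "0 < lam k" "eigenvalue_multiplicity G (lam k) = 1"
  shows "0 < spectral_gap lam k"
proof -
  have anti: "lam j \<le> lam i" if "1 \<le> i" "i \<le> j" for i j
    using lists that by (auto simp: lists_positive_eigenvalues_def monotone_on_def)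
  \<comment> \<open>Multiplicity one means that the value \<open>lam k\<close> occupies a single
    position, so the neighbouring entries differ from it and monotonicity makes the differences
    strict.\<close>
  have "card {j \<in> {1..}. lam j = lam k} = 1"
    using lists k by (auto simp: lists_positive_eigenvalues_def one_enat_def)
  then obtain i where i: "{j \<in> {1..}. lam j = lam k} = {i}"
    by (rule card_1_singletonE)
  then have uniq: "j = k" if "1 \<le> j" "lam j = lam k" for j
  proof -
    have "j \<in> {i}" "k \<in> {i}"
      unfolding i[symmetric] using that k(1) by simp_all
    then show ?thesis by simp
  qed
  have "lam (Suc k) \<noteq> lam k" "lam (Suc k) \<le> lam k"
    using anti[of k "Suc k"] uniq[of "Suc k"] k(1) by auto
  \<comment> \<open>For \<open>k = 1\<close> there is no left neighbour: index 0 lies outside the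
    list.\<close>
  moreover have "lam (k - 1) \<noteq> lam k" "lam k \<le> lam (k - 1)" if "k \<noteq> 1"
  proof -
    have "1 \<le> k - 1" "k - 1 \<noteq> k" using that k(1) by simp_all
    then show "lam (k - 1) \<noteq> lam k" "lam k \<le> lam (k - 1)"
      using anti[of "k - 1" k] uniq[of "k - 1"] by auto
  qed
  ultimately show ?thesis
    using k(1) by (auto simp: spectral_gap_def numeral_2_eq_2)
qed

lemma
  shows spectral_gap_le_next: "spectral_gap lam k \<le> lam k - lam (Suc k)"
    and spectral_gap_le_prev: "2 \<le> k \<Longrightarrow> spectral_gap lam k \<le> lam (k - 1) - lam k"
  by (auto simp: spectral_gap_def numeral_2_eq_2)

theorem proposition1:
  fixes \<Gamma> \<Gamma>h :: "real \<times> real \<Rightarrow> real"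
    and lam lamh :: "nat \<Rightarrow> real"
    and \<phi> \<phi>h :: "nat \<Rightarrow> real \<Rightarrow> real"
    and k :: nat
  assumes "covariance_kernel \<Gamma>"
    and "\<forall>j\<ge>1. 0 \<le> lam j"
    and "lists_positive_eigenvalues \<Gamma> lam"
    and "orthonormal_eigenfunctions \<Gamma> {1..} lam \<phi>"
    and "continuous_on unit_square \<Gamma>h" and "symmetric_kernel \<Gamma>h"
    and "lists_positive_eigenvalues \<Gamma>h lamh"
    and "orthonormal_eigenfunctions \<Gamma>h {j \<in> {1..}. 0 < lamh j} lamh \<phi>h"
    and "1 \<le> k"
    and "0 < lam k" and "eigenvalue_multiplicity \<Gamma> (lam k) = 1"
    and "0 < lamh k"
  shows "sup_norm {0..1} (\<lambda>x. \<phi>h k x - sgn (L2_inner (\<phi>h k) (\<phi> k)) * \<phi> k x)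
    \<le> sup_norm unit_square (\<lambda>p. \<Gamma>h p - \<Gamma> p) *
      (1 / lamh k
       + sup_norm unit_square \<Gamma> / (lamh k * lam k)
       + 2 * sqrt 2 * sup_norm unit_square \<Gamma> / (spectral_gap lam k * lam k))"
proof -
  note k = assms(9,10,12)
  have G: "continuous_on unit_square \<Gamma>" "symmetric_kernel \<Gamma>"
    using assms(1) by (auto simp: covariance_kernel_def)
  note Gh = assms(5,6)
  have Gdiff: "continuous_on unit_square (\<lambda>p. \<Gamma>h p - \<Gamma> p)"
    using G Gh by (intro continuous_intros)
  define \<epsilon> where "\<epsilon> = sup_norm unit_square (\<lambda>p. \<Gamma>h p - \<Gamma> p)"
  define B where "B = sup_norm unit_square \<Gamma>"
  define \<delta> where "\<delta> = spectral_gap lam k"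
  define T where "T = kernel_op \<Gamma>"
  define S where "S = kernel_op \<Gamma>h"
  define f where "f = mk_cont01 (\<phi> k)"
  define g where "g = mk_cont01 (\<phi>h k)"
  define c where "c = sgn (L2_inner (\<phi>h k) (\<phi> k))"
  have "orthonormal_eigenfunctions \<Gamma> {j \<in> {1..}. 0 < lam j} lam \<phi>"
    using assms(4) by (auto simp: orthonormal_eigenfunctions_def)
  then have eT: "eigenlist T lam (\<lambda>j. mk_cont01 (\<phi> j))"
    unfolding T_def by (rule eigenlist_kernel_op[OF G assms(3)])
  have eS: "eigenlist S lamh (\<lambda>j. mk_cont01 (\<phi>h j))"
    unfolding S_def by (rule eigenlist_kernel_op[OF Gh assms(7,8)])
  interpret T: eigenlist T lam "\<lambda>j. mk_cont01 (\<phi> j)" by (rule eT)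
  interpret S: eigenlist S lamh "\<lambda>j. mk_cont01 (\<phi>h j)" by (rule eS)
  have cont: "continuous_on {0..1} (\<phi> k)" "continuous_on {0..1} (\<phi>h k)"
    using assms(4,8) k by (auto simp: orthonormal_eigenfunctions_def)
  have norm_diff: "norm (T h - S h) \<le> \<epsilon> * norm h" for h
    using norm_kernel_op_le[OF Gdiff, of h]
    by (simp add: T_def S_def \<epsilon>_def kernel_op_diff[OF Gh(1) G(1), symmetric] norm_minus_commute)
  have \<delta>: "0 < \<delta>" "\<delta> \<le> lam k - lam (Suc k)" "2 \<le> k \<Longrightarrow> \<delta> \<le> lam (k - 1) - lam k"
    unfolding \<delta>_def using spectral_gap_simple[OF assms(3,9,10,11)]
      spectral_gap_le_next spectral_gap_le_prev by blast+
  have c: "c = sgn (inner g f)"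
    by (simp add: c_def f_def g_def inner_mk_cont01 cont)
  \<comment> \<open>The open premise \<open>0 \<le> lam (Suc k)\<close> comes from the nonnegativity
    of all terms of \<open>lam\<close>.\<close>
  have dk: "norm (g - c *\<^sub>R f) \<le> 2 * sqrt 2 * \<epsilon> / \<delta>"
    using davis_kahan[OF eT eS k _ \<delta> norm_diff] assms(2) by (simp add: c f_def g_def)
  have weyl: "\<bar>lam k - lamh k\<bar> \<le> \<epsilon>"
    by (rule weyl[OF eT eS k norm_diff])
  have g1: "norm g = 1"
    using S.orthonormal[of k k] k by (simp add: g_def norm_eq_sqrt_inner)
  have eig: "T f = lam k *\<^sub>R f" "S g = lamh k *\<^sub>R g"
    using T.eigen[of k] S.eigen[of k] k by (simp_all add: f_def g_def)
  have B0: "0 \<le> B"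
    using abs_le_sup_norm[OF compact_unit_square G(1), of "(0, 0)"] by (simp add: B_def)
  \<comment> \<open>One summand for each term of the decomposition \<open>decomp\<close>; the last
    contains the Davis-Kahan bound \<open>dk\<close>.\<close>
  define R where "R = \<epsilon> / lamh k + \<epsilon> * B / (lamh k * lam k) + B * (2 * sqrt 2 * \<epsilon> / \<delta>) / lam k"
  have decomp: "g - c *\<^sub>R f = (1 / lamh k) *\<^sub>R (S g - T g) + ((lam k - lamh k) / (lamh k * lam k)) *\<^sub>R T g
      + (1 / lam k) *\<^sub>R T (g - c *\<^sub>R f)"
  proof -
    \<comment> \<open>In this form the coefficients of \<open>T g\<close> add up to
      \<open>- 1/lamh + (1/lamh - 1/lam) + 1/lam = 0\<close>, while the quotient form is the one to
      which Weyl's bound applies.\<close>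
    have "(lam k - lamh k) / (lamh k * lam k) = 1 / lamh k - 1 / lam k"
      using k by (simp add: field_simps)
    then show ?thesis
      using k by (simp add: eig T.diff T.scaleR scaleR_diff_left scaleR_diff_right)
  qed
  have pointwise: "\<bar>\<phi>h k x - c * \<phi> k x\<bar> \<le> R" if x: "x \<in> {0..1}" for x
  proof -
    have "\<phi>h k x - c * \<phi> k x = cfun (g - c *\<^sub>R f) x"
      using x by (simp add: f_def g_def cfun_mk_cont01 cont del: atLeastAtMost_iff)
    also have "\<dots> = (1 / lamh k) * cfun (S g - T g) x
        + ((lam k - lamh k) / (lamh k * lam k)) * cfun (T g) x + (1 / lam k) * cfun (T (g - c *\<^sub>R f)) x"
      by (subst decomp) (simp only: plus_cont01.rep_eq scaleR_cont01.rep_eq)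
    also have "\<bar>\<dots>\<bar> \<le> (1 / lamh k) * \<bar>cfun (S g - T g) x\<bar>
        + (\<bar>lam k - lamh k\<bar> / (lamh k * lam k)) * \<bar>cfun (T g) x\<bar>
        + (1 / lam k) * \<bar>cfun (T (g - c *\<^sub>R f)) x\<bar>"
      using k by (intro order_trans[OF abs_triangle_ineq] add_mono) (auto simp: abs_mult)
    \<comment> \<open>The first two terms use the L2-to-sup bound with \<open>norm g = 1\<close>,
      for the kernels \<open>\<Gamma>h - \<Gamma>\<close> and \<open>\<Gamma>\<close>, the second
      together with Weyl's inequality. The third applies that bound for \<open>\<Gamma>\<close> to
      \<open>g - c f\<close> and then \<open>dk\<close>.\<close>
    also have "\<dots> \<le> (1 / lamh k) * \<epsilon> + (\<epsilon> / (lamh k * lam k)) * B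
        + (1 / lam k) * (B * (2 * sqrt 2 * \<epsilon> / \<delta>))"
    proof (intro add_mono mult_mono)
      show "\<bar>cfun (S g - T g) x\<bar> \<le> \<epsilon>"
        using abs_kernel_op_le[OF Gdiff x, of g] g1
        by (simp add: S_def T_def \<epsilon>_def kernel_op_diff[OF Gh(1) G(1)] del: minus_cont01.rep_eq)
      show "\<bar>cfun (T g) x\<bar> \<le> B"
        using abs_kernel_op_le[OF G(1) x, of g] g1 by (simp add: T_def B_def)
      show "\<bar>cfun (T (g - c *\<^sub>R f)) x\<bar> \<le> B * (2 * sqrt 2 * \<epsilon> / \<delta>)"
        using abs_kernel_op_le[OF G(1) x, of "g - c *\<^sub>R f"] mult_left_mono[OF dk B0]
        by (simp add: T_def B_def)
      show "\<bar>lam k - lamh k\<bar> / (lamh k * lam k) \<le> \<epsilon> / (lamh k * lam k)"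
        using weyl k by (intro divide_right_mono) auto
    qed (use k weyl in auto)
    also have "\<dots> = R" by (simp add: R_def)
    finally show ?thesis .
  qed
  have "sup_norm {0..1} (\<lambda>x. \<phi>h k x - c * \<phi> k x) \<le> R"
    unfolding sup_norm_def by (rule cSUP_least) (use pointwise in auto)
  also have "R = \<epsilon> * (1 / lamh k + B / (lamh k * lam k) + 2 * sqrt 2 * B / (\<delta> * lam k))"
    by (simp add: R_def algebra_simps)
  finally show ?thesis
    by (simp only: c_def \<epsilon>_def B_def \<delta>_def)
qed

end
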